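(* Let $\mathcal{A}$ be a finite or countable alphabet and $\mathcal{M}$ a set of $K<\infty$ probability measures on $\mathcal{A}^\infty$, let $w$ be the uniform prior $w_\nu=1/K$, $\xi$ the Bayes mixture and $\mu\in\mathcal{M}$. Then $\mathbb{E}_\mu C_\infty\le 6\ln^2 K+14\ln K+8$.
   Context: $\mathcal{A}^\infty$ carries the $\sigma$-algebra generated by cylinders $\Gamma_x=\{x\omega\}$; for a measure $\rho$, $\rho(x):=\rho(\Gamma_x)$, $\rho(y|x):=\rho(xy)/\rho(x)$. Bayes mixture: $\xi(A):=\sum_{\nu\in\mathcal{M}}w_\nu\nu(A)$; posterior $w_\nu(x):=w_\nu\nu(x)/\xi(x)$. Logarithms are natural. For a finite string $x$ and $\nu\in\mathcal{M}$, $d_x(\nu,\xi):=\sum_{a\in\mathcal{A}}\nu(a|x)\ln\frac{\nu(a|x)}{\xi(a|x)}$. For $\omega\in\mathcal{A}^\infty$, $c_t(\omega):=\sum_{\nu\in\mathcal{M}}w_\nu(\omega_{<t})\,d_{\omega_{<t}}(\nu,\xi)$ with $\omega_{<t}=\omega_1\cdots\omega_{t-1}$, and $C_\infty:=\sum_{t=1}^\infty c_t$. *)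

theory Defs
  imports "HOL-Probability.Probability"
begin

text \<open>Finite strings are lists, infinite sequences are streams over a countable
  (possibly finite) alphabet type. Measures live on the stream space with the
  discrete sigma-algebra on the alphabet, i.e. the sigma-algebra generated by cylinders.\<close>

definition cyl :: "'a list \<Rightarrow> 'a stream set" where
  "cyl x = {\<omega>. stake (length x) \<omega> = x}"

definition cprob :: "'a stream measure \<Rightarrow> 'a list \<Rightarrow> real" where
  "cprob \<rho> x = measure \<rho> (cyl x)"

definition ccond :: "'a stream measure \<Rightarrow> 'a list \<Rightarrow> 'a list \<Rightarrow> real" where
  "ccond \<rho> y x = cprob \<rho> (x @ y) / cprob \<rho> x"

definition mix :: "('a stream measure \<Rightarrow> real) \<Rightarrow> 'a stream measure set \<Rightarrow> 'a list \<Rightarrow> real" where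
  "mix w M x = (\<Sum>\<nu>\<in>M. w \<nu> * cprob \<nu> x)"

definition mixcond :: "('a stream measure \<Rightarrow> real) \<Rightarrow> 'a stream measure set \<Rightarrow> 'a list \<Rightarrow> 'a list \<Rightarrow> real" where
  "mixcond w M y x = mix w M (x @ y) / mix w M x"

definition post :: "('a stream measure \<Rightarrow> real) \<Rightarrow> 'a stream measure set \<Rightarrow> 'a stream measure \<Rightarrow> 'a list \<Rightarrow> real" where
  "post w M \<nu> x = w \<nu> * cprob \<nu> x / mix w M x"

definition dKL :: "('a stream measure \<Rightarrow> real) \<Rightarrow> 'a stream measure set \<Rightarrow> 'a list \<Rightarrow> 'a stream measure \<Rightarrow> real" where
  "dKL w M x \<nu> = (\<Sum>\<^sub>\<infinity>a\<in>UNIV. ccond \<nu> [a] x * ln (ccond \<nu> [a] x / mixcond w M [a] x))"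

definition ct :: "('a stream measure \<Rightarrow> real) \<Rightarrow> 'a stream measure set \<Rightarrow> nat \<Rightarrow> 'a stream \<Rightarrow> real" where
  "ct w M t \<omega> = (\<Sum>\<nu>\<in>M. post w M \<nu> (stake (t - 1) \<omega>) * dKL w M (stake (t - 1) \<omega>) \<nu>)"

text \<open>C_infinity = sum_{t>=1} c_t (nonnegative terms, summed in ennreal)\<close>
definition Cinf :: "('a stream measure \<Rightarrow> real) \<Rightarrow> 'a stream measure set \<Rightarrow> 'a stream \<Rightarrow> ennreal" where
  "Cinf w M \<omega> = (\<Sum>t. ennreal (ct w M (Suc t) \<omega>))"

end

theory Submission
  imports Defs
begin

text \<open>Let \<open>h\<close> be the entropy of the posterior; it is at most \<open>L = ln K\<close>, and \<open>c\<^sub>t\<close> is its expected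
  decrease under \<open>\<xi>\<close> in step \<open>t\<close>. Put \<open>B = L + 1\<close>. Since \<open>exp (c / (2 B)) (1 + (h - c) / B) \<le> 1 + h / B\<close>
  for \<open>c \<ge> 0\<close> and \<open>h \<le> B\<close>, the process \<open>exp (C\<^sub>t / (2 B)) (1 + h\<^sub>t / B)\<close> is a \<open>\<xi>\<close>-supermartingale with
  initial value at most 2. As \<open>\<mu> \<le> K \<xi>\<close>, the \<open>\<mu>\<close>-expectation of \<open>exp (C\<^sub>\<infinity> / (2 B))\<close> is at most \<open>2 K\<close>,
  and \<open>y \<le> ln (2 K) + exp y / (2 K)\<close> turns this into the bound \<open>2 B (ln (2 K) + 1)\<close> on the expectation
  of \<open>C\<^sub>\<infinity>\<close>.\<close>

section \<open>Countable sums, cylinders and integrals of prefix functions\<close>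

text \<open>Entropy identities involve subtraction and are stated with \<open>has_sum\<close>, while
  expectations are iterated as \<open>nn_integral\<close>; this passes between the two.\<close>

lemma has_sum_iff_nn_integral_count_space:
  fixes f :: "'b \<Rightarrow> real"
  assumes f: "\<And>x. f x \<ge> 0" and s: "s \<ge> 0"
  shows "(f has_sum s) UNIV \<longleftrightarrow> (\<integral>\<^sup>+x. f x \<partial>count_space UNIV) = ennreal s"
proof
  assume fs: "(f has_sum s) UNIV"
  have "Infinite_Set_Sum.abs_summable_on f UNIV"
    using fs f by (subst abs_summable_equivalent[symmetric]) (auto simp: has_sum_imp_summable)
  then show "(\<integral>\<^sup>+x. f x \<partial>count_space UNIV) = ennreal s"
    using fs f by (simp add: nn_integral_conv_infsetsum infsetsum_infsum infsumI)
next
  assume eq: "(\<integral>\<^sup>+x. f x \<partial>count_space UNIV) = ennreal s"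
  then have a: "Infinite_Set_Sum.abs_summable_on f UNIV"
    unfolding Infinite_Set_Sum.abs_summable_on_def using f by (intro integrableI_nonneg) auto
  have sm: "f summable_on UNIV"
    using a f by (subst (asm) abs_summable_equivalent[symmetric]) auto
  have "ennreal (infsum f UNIV) = ennreal s"
    using eq a f by (simp add: nn_integral_conv_infsetsum infsetsum_infsum)
  then have "infsum f UNIV = s"
    using s f by (simp add: infsum_nonneg)
  then show "(f has_sum s) UNIV"
    using sm by (simp add: has_sum_iff)
qed

lemma has_sum_sum:
  fixes f :: "'i \<Rightarrow> 'b \<Rightarrow> real"
  assumes "\<And>i. i \<in> I \<Longrightarrow> (f i has_sum s i) A"
  shows "((\<lambda>x. \<Sum>i\<in>I. f i x) has_sum (\<Sum>i\<in>I. s i)) A"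
  using assms by (induction I rule: infinite_finite_induct) (auto intro: has_sum_add)

lemma cyl_eq_vimage: "cyl x = stake (length x) -` {x}"
  by (auto simp: cyl_def)

lemma cyl_Nil [simp]: "cyl [] = UNIV"
  by (simp add: cyl_def)

lemma cyl_sets:
  fixes x :: "'a::countable list"
  assumes "sets \<nu> = sets (stream_space (count_space UNIV))"
  shows "cyl x \<in> sets \<nu>"
proof -
  have "stake (length x) -` {x} \<inter> space (stream_space (count_space UNIV))
      \<in> sets (stream_space (count_space UNIV))"
    by (rule measurable_sets[OF measurable_stake]) auto
  then show ?thesis
    by (simp add: assms cyl_eq_vimage space_stream_space)
qed

lemma cyl_snoc_Union: "cyl x = (\<Union>a. cyl (x @ [a]))"
  by (auto simp: cyl_def stake_Suc simp del: stake.simps(2))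

lemma disjoint_cyl_snoc: "disjoint_family (\<lambda>a. cyl (x @ [a]))"
  by (auto simp: disjoint_family_on_def cyl_def)

lemma cprob_snoc_has_sum:
  fixes x :: "'a::countable list"
  assumes "prob_space \<nu>" and s: "sets \<nu> = sets (stream_space (count_space UNIV))"
  shows "((\<lambda>a. cprob \<nu> (x @ [a])) has_sum cprob \<nu> x) UNIV"
proof -
  interpret prob_space \<nu> by fact
  have "emeasure \<nu> (cyl x) = (\<integral>\<^sup>+a. emeasure \<nu> (cyl (x @ [a])) \<partial>count_space UNIV)"
    unfolding cyl_snoc_Union[of x]
    by (rule emeasure_UN_countable) (auto intro: cyl_sets[OF s] disjoint_cyl_snoc)
  then show ?thesis
    by (subst has_sum_iff_nn_integral_count_space) (auto simp: cprob_def emeasure_eq_measure)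
qed

text \<open>The integrand is a sum of cylinder indicators over countably many words, and this sum
  may be exchanged with the integral.\<close>

lemma nn_integral_stake:
  fixes g :: "'a::countable list \<Rightarrow> ennreal"
  assumes s: "sets \<nu> = sets (stream_space (count_space UNIV))"
  shows "(\<integral>\<^sup>+\<omega>. g (stake n \<omega>) \<partial>\<nu>) = (\<integral>\<^sup>+x. g x * emeasure \<nu> (cyl x) \<partial>count_space {x. length x = n})"
proof -
  have "g (stake n \<omega>) = (\<integral>\<^sup>+x. g x * indicator (cyl x) \<omega> \<partial>count_space {x. length x = n})" for \<omega>
    by (subst nn_integral_count_space'[where A = "{stake n \<omega>}"]) (auto simp: cyl_def split: split_indicator)
  then have "(\<integral>\<^sup>+\<omega>. g (stake n \<omega>) \<partial>\<nu>)
      = (\<integral>\<^sup>+\<omega>. (\<integral>\<^sup>+x. g x * indicator (cyl x) \<omega> \<partial>count_space {x. length x = n}) \<partial>\<nu>)"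
    by simp
  also have "\<dots> = (\<integral>\<^sup>+x. (\<integral>\<^sup>+\<omega>. g x * indicator (cyl x) \<omega> \<partial>\<nu>) \<partial>count_space {x. length x = n})"
    using cyl_sets[OF s] by (intro nn_integral_count_space_nn_integral) auto
  also have "\<dots> = (\<integral>\<^sup>+x. g x * emeasure \<nu> (cyl x) \<partial>count_space {x. length x = n})"
    using cyl_sets[OF s] by (simp add: nn_integral_cmult_indicator)
  finally show ?thesis .
qed

text \<open>Appending a last letter is a bijection; summing over that letter first is what an
  induction on the word length needs.\<close>

lemma nn_integral_count_space_length_Suc:
  fixes g :: "'a list \<Rightarrow> ennreal"
  shows "(\<integral>\<^sup>+y. g y \<partial>count_space {y. length y = Suc n})
    = (\<integral>\<^sup>+x. (\<integral>\<^sup>+a. g (x @ [a]) \<partial>count_space UNIV) \<partial>count_space {x. length x = n})"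
proof -
  let ?N = "{x::'a list. length x = n}"
  have bij: "bij_betw (\<lambda>(x, a). x @ [a]) (?N \<times> UNIV) {y. length y = Suc n}"
    by (rule bij_betw_byWitness[where f' = "\<lambda>y. (butlast y, last y)"])
       (auto simp: append_butlast_last_id simp flip: length_greater_0_conv)
  have "(\<integral>\<^sup>+y. g y \<partial>count_space {y. length y = Suc n})
      = (\<integral>\<^sup>+z. g (case z of (x, a) \<Rightarrow> x @ [a]) \<partial>count_space (?N \<times> UNIV))"
    using nn_integral_bij_count_space[OF bij, of g] by simp
  also have "\<dots> = (\<integral>\<^sup>+z. g (case z of (x, a) \<Rightarrow> x @ [a]) * indicator (?N \<times> UNIV) z \<partial>count_space UNIV)"
    by (simp add: nn_integral_count_space_indicator)
  also have "\<dots> = (\<integral>\<^sup>+x. (\<integral>\<^sup>+a. g (x @ [a]) * indicator (?N \<times> UNIV) (x, a) \<partial>count_space UNIV) \<partial>count_space UNIV)"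
    by (subst nn_integral_fst_count_space[symmetric]) simp
  also have "\<dots> = (\<integral>\<^sup>+x. (\<integral>\<^sup>+a. g (x @ [a]) \<partial>count_space UNIV) * indicator ?N x \<partial>count_space UNIV)"
    by (intro nn_integral_cong) (auto split: split_indicator)
  also have "\<dots> = (\<integral>\<^sup>+x. (\<integral>\<^sup>+a. g (x @ [a]) \<partial>count_space UNIV) \<partial>count_space ?N)"
    by (simp add: nn_integral_count_space_indicator)
  finally show ?thesis .
qed

text \<open>With \<open>u = c / (2 * B)\<close>, the bound \<open>exp (- u) >= 1 - u\<close> reduces
  the claim to a comparison of polynomials in \<open>c\<close> and \<open>h\<close>.\<close>

lemma exp_entropy_drop:
  fixes c h B :: real
  assumes "0 < B" "0 \<le> c" "0 \<le> h" "h \<le> B"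
  shows "exp (c / (2 * B)) * (1 + (h - c) / B) \<le> 1 + h / B"
proof -
  have "(1 - c / (2 * B)) * (1 + h / B) \<le> exp (- (c / (2 * B))) * (1 + h / B)"
    using exp_ge_add_one_self[of "- (c / (2 * B))"] assms by (intro mult_right_mono) auto
  moreover have "1 + (h - c) / B \<le> (1 - c / (2 * B)) * (1 + h / B)"
  proof -
    \<comment> \<open>The assumption \<open>h <= B\<close> enters here; the resulting factor 2 is
      the one in the exponent \<open>c / (2 * B)\<close>.\<close>
    have "c * (1 + h / B) \<le> c * 2"
      using assms by (intro mult_left_mono) auto
    then have "c * (1 + h / B) / (2 * B) \<le> c * 2 / (2 * B)"
      using assms by (intro divide_right_mono) auto
    then show ?thesis
      by (simp add: algebra_simps diff_divide_distrib)
  qed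
  ultimately have "exp (c / (2 * B)) * (1 + (h - c) / B)
      \<le> exp (c / (2 * B)) * (exp (- (c / (2 * B))) * (1 + h / B))"
    by (intro mult_left_mono) auto
  then show ?thesis
    by (simp add: mult.assoc[symmetric] exp_minus)
qed

section \<open>Joint weights and posterior entropy for a positive prior\<close>

locale bayes_mixture =
  fixes M :: "('a::countable) stream measure set" and w :: "'a stream measure \<Rightarrow> real"
  assumes finite_M: "finite M"
    and prob_M: "\<And>\<nu>. \<nu> \<in> M \<Longrightarrow> prob_space \<nu>"
    and sets_M: "\<And>\<nu>. \<nu> \<in> M \<Longrightarrow> sets \<nu> = sets (stream_space (count_space UNIV))"
    and w_pos: "\<And>\<nu>. \<nu> \<in> M \<Longrightarrow> 0 < w \<nu>"
    and sum_w: "(\<Sum>\<nu>\<in>M. w \<nu>) = 1"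
begin

definition joint :: "'a stream measure \<Rightarrow> 'a list \<Rightarrow> real" where
  "joint \<nu> x = w \<nu> * cprob \<nu> x"

text \<open>Scaling by \<open>mix w M x\<close> turns conditional expectations under the mixture
  into plain sums over the next letter. A zero joint weight contributes 0, the usual entropy
  convention.\<close>

definition ent_term :: "'a stream measure \<Rightarrow> 'a list \<Rightarrow> real" where
  "ent_term \<nu> x = joint \<nu> x * ln (mix w M x / joint \<nu> x)"

text \<open>The posterior entropy at \<open>x\<close>, multiplied by \<open>\<xi>(x)\<close>.\<close>
definition ent :: "'a list \<Rightarrow> real" where
  "ent x = (\<Sum>\<nu>\<in>M. ent_term \<nu> x)"

text \<open>This is \<open>ct\<close> as a function of the prefix: \<open>ct w M (Suc t)\<close> at
  a sequence is \<open>gain\<close> of its first \<open>t\<close> letters.\<close>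

definition gain :: "'a list \<Rightarrow> real" where
  "gain x = (\<Sum>\<nu>\<in>M. post w M \<nu> x * dKL w M x \<nu>)"

text \<open>Only proper prefixes count, so the value at \<open>x @ [a]\<close> does not depend on
  \<open>a\<close>.\<close>

definition cum_gain :: "'a list \<Rightarrow> real" where
  "cum_gain x = (\<Sum>t<length x. gain (take t x))"

lemma M_nonempty: "M \<noteq> {}"
  using sum_w by auto

lemma card_M_ge_1: "1 \<le> real (card M)"
  using finite_M M_nonempty by (simp add: Suc_le_eq card_gt_0_iff)

lemma joint_nonneg: "\<nu> \<in> M \<Longrightarrow> 0 \<le> joint \<nu> x"
  using w_pos[of \<nu>] by (simp add: joint_def cprob_def)

lemma mix_eq_sum_joint: "mix w M x = (\<Sum>\<nu>\<in>M. joint \<nu> x)"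
  by (simp add: mix_def joint_def)

lemma joint_le_mix: "\<nu> \<in> M \<Longrightarrow> joint \<nu> x \<le> mix w M x"
  unfolding mix_eq_sum_joint by (rule member_le_sum) (auto simp: finite_M joint_nonneg)

lemma mix_nonneg: "0 \<le> mix w M x"
  unfolding mix_eq_sum_joint by (simp add: sum_nonneg joint_nonneg)

lemma mix_Nil: "mix w M [] = 1"
proof -
  have "cprob \<nu> [] = 1" if "\<nu> \<in> M" for \<nu>
  proof -
    interpret prob_space \<nu> by (rule prob_M[OF that])
    have "space \<nu> = UNIV"
      using sets_eq_imp_space_eq[OF sets_M[OF that]] by (simp add: space_stream_space)
    then show ?thesis
      using prob_space by (simp add: cprob_def)
  qed
  then show ?thesis
    by (simp add: mix_def sum_w)
qed

lemma joint_snoc_has_sum: "\<nu> \<in> M \<Longrightarrow> ((\<lambda>a. joint \<nu> (x @ [a])) has_sum joint \<nu> x) UNIV"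
  unfolding joint_def by (intro has_sum_cmult_right cprob_snoc_has_sum prob_M sets_M)

lemma mix_snoc_has_sum: "((\<lambda>a. mix w M (x @ [a])) has_sum mix w M x) UNIV"
  unfolding mix_eq_sum_joint by (intro has_sum_sum joint_snoc_has_sum)

lemma joint_snoc_eq_0:
  assumes "\<nu> \<in> M" "joint \<nu> x = 0"
  shows "joint \<nu> (x @ [a]) = 0"
  using nonneg_has_sum_le_0D[OF joint_snoc_has_sum[OF assms(1), of x]] assms joint_nonneg by auto

lemma ent_term_nonneg: "\<nu> \<in> M \<Longrightarrow> 0 \<le> ent_term \<nu> x"
  using joint_nonneg[of \<nu> x] joint_le_mix[of \<nu> x]
  by (cases "joint \<nu> x = 0") (auto simp: ent_term_def intro!: mult_nonneg_nonneg ln_ge_zero)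

text \<open>Tangent bound \<open>ln u <= u - 1\<close> with a free scale \<open>b\<close>. It is
  used with \<open>b\<close> the number of measures (entropy bound), \<open>b = 1\<close>
  (summability) and \<open>b\<close> the inverse posterior (nonnegative divergence).\<close>

lemma ent_term_le:
  assumes "\<nu> \<in> M" "0 < b"
  shows "ent_term \<nu> x \<le> joint \<nu> x * ln b + mix w M x / b - joint \<nu> x"
proof (cases "joint \<nu> x = 0")
  case True
  then show ?thesis
    using mix_nonneg[of x] assms by (simp add: ent_term_def)
next
  case False
  then have p: "0 < joint \<nu> x" and m: "0 < mix w M x"
    using joint_nonneg[OF assms(1), of x] joint_le_mix[OF assms(1), of x] by auto
  have "ln (mix w M x / joint \<nu> x) - ln b = ln (mix w M x / (b * joint \<nu> x))"
    using p m assms by (simp add: ln_div ln_mult)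
  also have "\<dots> \<le> mix w M x / (b * joint \<nu> x) - 1"
    using p m assms by (intro ln_le_minus_one) auto
  finally have "joint \<nu> x * (ln (mix w M x / joint \<nu> x) - ln b)
      \<le> joint \<nu> x * (mix w M x / (b * joint \<nu> x) - 1)"
    using p by (intro mult_left_mono) auto
  also have "\<dots> = mix w M x / b - joint \<nu> x"
    using p assms by (simp add: field_simps)
  finally show ?thesis
    by (simp add: ent_term_def algebra_simps)
qed

lemma ent_nonneg: "0 \<le> ent x"
  by (simp add: ent_def sum_nonneg ent_term_nonneg)

lemma ent_le: "ent x \<le> mix w M x * ln (real (card M))"
proof -
  have "ent x \<le> (\<Sum>\<nu>\<in>M. joint \<nu> x * ln (real (card M)) + mix w M x / real (card M) - joint \<nu> x)"
    unfolding ent_def using card_M_ge_1 by (intro sum_mono ent_term_le) auto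
  \<comment> \<open>Summed over \<open>M\<close>, the two last terms cancel, both giving
    \<open>mix w M x\<close>.\<close>
  also have "\<dots> = mix w M x * ln (real (card M))"
    using card_M_ge_1
    by (simp add: sum_subtractf sum.distrib flip: sum_distrib_right mix_eq_sum_joint)
  finally show ?thesis .
qed

section \<open>Expected one-step decrease of the entropy\<close>

lemma ent_term_snoc_summable:
  assumes "\<nu> \<in> M"
  shows "(\<lambda>a. ent_term \<nu> (x @ [a])) summable_on UNIV"
proof (rule summable_on_comparison_test)
  show "(\<lambda>a. mix w M (x @ [a])) summable_on UNIV"
    using mix_snoc_has_sum by (rule has_sum_imp_summable)
  show "ent_term \<nu> (x @ [a]) \<le> mix w M (x @ [a])" for a
    using ent_term_le[OF assms, of 1 "x @ [a]"] joint_nonneg[OF assms, of "x @ [a]"] by simp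
qed (use ent_term_nonneg[OF assms] in auto)

text \<open>The ratio inside the divergence is the inverse posterior at \<open>x\<close> divided by
  that at \<open>x @ [a]\<close>, so its logarithm splits into two summable parts. In particular the
  divergence is a genuine sum, also over an infinite alphabet.\<close>

lemma ent_term_snoc_has_sum:
  assumes \<nu>: "\<nu> \<in> M"
  shows "((\<lambda>a. ent_term \<nu> (x @ [a])) has_sum (ent_term \<nu> x - joint \<nu> x * dKL w M x \<nu>)) UNIV"
proof (cases "joint \<nu> x = 0")
  case True
  then show ?thesis
    using joint_snoc_eq_0[OF \<nu> True] by (simp add: ent_term_def)
next
  case False
  then have p: "0 < joint \<nu> x" and m: "0 < mix w M x"
    using joint_nonneg[OF \<nu>, of x] joint_le_mix[OF \<nu>, of x] by auto
  define R where "R = (\<Sum>\<^sub>\<infinity>a. ent_term \<nu> (x @ [a]))"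
  have R: "((\<lambda>a. ent_term \<nu> (x @ [a])) has_sum R) UNIV"
    unfolding R_def using ent_term_snoc_summable[OF \<nu>] by (rule has_sum_infsum)
  have cc: "ccond \<nu> [a] x = joint \<nu> (x @ [a]) / joint \<nu> x" for a
    using w_pos[OF \<nu>] by (simp add: ccond_def joint_def)
  have "ccond \<nu> [a] x * ln (ccond \<nu> [a] x / mixcond w M [a] x)
      = (joint \<nu> (x @ [a]) * ln (mix w M x / joint \<nu> x) + - ent_term \<nu> (x @ [a])) * (1 / joint \<nu> x)" for a
  proof (cases "joint \<nu> (x @ [a]) = 0")
    case False
    then have "0 < joint \<nu> (x @ [a])" "0 < mix w M (x @ [a])"
      using joint_nonneg[OF \<nu>, of "x @ [a]"] joint_le_mix[OF \<nu>, of "x @ [a]"] by auto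
    then show ?thesis
      using p m unfolding cc mixcond_def ent_term_def
      by (simp add: ln_div ln_mult field_simps)
  qed (simp add: cc ent_term_def)
  moreover have "((\<lambda>a. (joint \<nu> (x @ [a]) * ln (mix w M x / joint \<nu> x) + - ent_term \<nu> (x @ [a])) * (1 / joint \<nu> x))
      has_sum ((joint \<nu> x * ln (mix w M x / joint \<nu> x) + - R) * (1 / joint \<nu> x))) UNIV"
    by (intro has_sum_cmult_left has_sum_add has_sum_uminusI joint_snoc_has_sum \<nu> R)
  ultimately have "dKL w M x \<nu> = (ent_term \<nu> x - R) / joint \<nu> x"
    unfolding dKL_def by (simp add: infsumI ent_term_def)
  then show ?thesis
    using R p by simp
qed

lemma mix_mult_gain: "mix w M x * gain x = (\<Sum>\<nu>\<in>M. joint \<nu> x * dKL w M x \<nu>)"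
proof -
  have "mix w M x * post w M \<nu> x = joint \<nu> x" if "\<nu> \<in> M" for \<nu>
    using joint_nonneg[OF that, of x] joint_le_mix[OF that, of x]
    by (auto simp: post_def joint_def)
  then show ?thesis
    unfolding gain_def sum_distrib_left mult.assoc[symmetric] by (intro sum.cong) auto
qed

text \<open>Chain rule: \<open>gain x\<close> is the mutual information between the next letter and
  the measure drawn from the posterior.\<close>

lemma ent_snoc_has_sum: "((\<lambda>a. ent (x @ [a])) has_sum (ent x - mix w M x * gain x)) UNIV"
  unfolding mix_mult_gain ent_def sum_subtractf[symmetric]
  by (intro has_sum_sum ent_term_snoc_has_sum)

text \<open>Gibbs' inequality. For \<open>b\<close> the inverse posterior at \<open>x\<close>, the
  bounds of \<open>ent_term_le\<close> at all \<open>x @ [a]\<close> sum to exactly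
  \<open>ent_term\<close> at \<open>x\<close>.\<close>

lemma joint_mult_dKL_nonneg:
  assumes \<nu>: "\<nu> \<in> M"
  shows "0 \<le> joint \<nu> x * dKL w M x \<nu>"
proof (cases "joint \<nu> x = 0")
  case False
  then have p: "0 < joint \<nu> x" and m: "0 < mix w M x"
    using joint_nonneg[OF \<nu>, of x] joint_le_mix[OF \<nu>, of x] by auto
  let ?b = "mix w M x / joint \<nu> x"
  have "((\<lambda>a. joint \<nu> (x @ [a]) * ln ?b + mix w M (x @ [a]) * (1 / ?b) + - joint \<nu> (x @ [a]))
      has_sum (joint \<nu> x * ln ?b + mix w M x * (1 / ?b) + - joint \<nu> x)) UNIV"
    by (intro has_sum_cmult_left has_sum_add has_sum_uminusI joint_snoc_has_sum \<nu> mix_snoc_has_sum)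
  with ent_term_snoc_has_sum[OF \<nu>, of x]
  have "ent_term \<nu> x - joint \<nu> x * dKL w M x \<nu> \<le> joint \<nu> x * ln ?b + mix w M x * (1 / ?b) + - joint \<nu> x"
  proof (rule has_sum_mono)
    show "ent_term \<nu> (x @ [a]) \<le> joint \<nu> (x @ [a]) * ln ?b + mix w M (x @ [a]) * (1 / ?b) + - joint \<nu> (x @ [a])" for a
      using ent_term_le[OF \<nu>, of ?b "x @ [a]"] p m by simp
  qed
  then show ?thesis
    using m by (simp add: ent_term_def)
qed simp

text \<open>Required by \<open>exp_entropy_drop\<close>, and it ensures that \<open>ennreal\<close>
  truncates no term of \<open>Cinf\<close>.\<close>

lemma gain_nonneg: "0 \<le> gain x"
proof (cases "mix w M x = 0")
  case True
  then show ?thesis by (simp add: gain_def post_def)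
next
  case False
  then have "0 < mix w M x" using mix_nonneg[of x] by simp
  moreover have "0 \<le> mix w M x * gain x"
    unfolding mix_mult_gain by (intro sum_nonneg joint_mult_dKL_nonneg)
  ultimately show ?thesis by (simp add: zero_le_mult_iff)
qed

lemma cum_gain_snoc: "cum_gain (x @ [a]) = cum_gain x + gain x"
  by (simp add: cum_gain_def)

lemma cum_gain_stake: "cum_gain (stake n \<omega>) = (\<Sum>t<n. gain (stake t \<omega>))"
  unfolding cum_gain_def by (intro sum.cong) (auto simp: take_stake min_def)

section \<open>The exponential supermartingale\<close>

text \<open>The added 1 keeps the bound positive when \<open>M\<close> is a singleton.\<close>

definition ent_bound :: real where
  "ent_bound = ln (real (card M)) + 1"

lemma ent_bound_pos: "0 < ent_bound"
  using ln_ge_zero[OF card_M_ge_1] by (simp add: ent_bound_def)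

text \<open>The supermartingale multiplied by the mixture probability of \<open>x\<close>; its sum
  over words of length \<open>n\<close> is an expectation under the mixture.\<close>

definition potential :: "'a list \<Rightarrow> real" where
  "potential x = exp (cum_gain x / (2 * ent_bound)) * (mix w M x + ent x / ent_bound)"

lemma potential_nonneg: "0 \<le> potential x"
  using ent_bound_pos ent_nonneg[of x] mix_nonneg[of x] by (simp add: potential_def)

lemma potential_snoc_le: "(\<integral>\<^sup>+a. potential (x @ [a]) \<partial>count_space UNIV) \<le> ennreal (potential x)"
proof -
  let ?m = "mix w M x"
  let ?s = "exp ((cum_gain x + gain x) / (2 * ent_bound)) * (?m + (ent x - ?m * gain x) * (1 / ent_bound))"
  \<comment> \<open>The exponential factor is the same for every \<open>a\<close>, so only
    \<open>mix\<close> and \<open>ent\<close> are summed.\<close>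
  have sum: "((\<lambda>a. potential (x @ [a])) has_sum ?s) UNIV"
    unfolding potential_def cum_gain_snoc divide_inverse[of "ent _"] inverse_eq_divide
    by (intro has_sum_cmult_right has_sum_add has_sum_cmult_left mix_snoc_has_sum ent_snoc_has_sum)
  have "?s \<le> potential x"
  proof (cases "?m = 0")
    case True
    then have "ent x = 0"
      using ent_nonneg[of x] ent_le[of x] by simp
    then show ?thesis
      using True by (simp add: potential_def)
  next
    case False
    then have m: "0 < ?m" using mix_nonneg[of x] by simp
    \<comment> \<open>The actual posterior entropy, with the scaling undone.\<close>
    define h where "h = ent x / ?m"
    have h: "ent x = ?m * h" using m by (simp add: h_def)
    have "h \<le> ln (real (card M))"
      using ent_le[of x] m by (simp add: h mult_le_cancel_left_pos)
    then have "exp (gain x / (2 * ent_bound)) * (1 + (h - gain x) / ent_bound) \<le> 1 + h / ent_bound"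
      using ent_nonneg[of x] m
      by (intro exp_entropy_drop ent_bound_pos gain_nonneg) (auto simp: h_def ent_bound_def)
    then have "(exp (cum_gain x / (2 * ent_bound)) * ?m) * (exp (gain x / (2 * ent_bound)) * (1 + (h - gain x) / ent_bound))
        \<le> (exp (cum_gain x / (2 * ent_bound)) * ?m) * (1 + h / ent_bound)"
      using m by (intro mult_left_mono) auto
    then show ?thesis
      by (simp add: potential_def h add_divide_distrib diff_divide_distrib exp_add algebra_simps)
  qed
  moreover have "0 \<le> ?s"
    using has_sum_nonneg[OF sum] potential_nonneg by simp
  ultimately show ?thesis
    using sum potential_nonneg by (subst (asm) has_sum_iff_nn_integral_count_space) (auto intro: ennreal_leI)
qed

lemma nn_integral_potential_le: "(\<integral>\<^sup>+x. potential x \<partial>count_space {x. length x = n}) \<le> 2"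
proof (induction n)
  case 0
  have "ent [] / ent_bound \<le> 1"
    using ent_le[of "[]"] ent_bound_pos by (simp add: mix_Nil ent_bound_def)
  then have "potential [] \<le> 2"
    by (simp add: potential_def cum_gain_def mix_Nil)
  then have "ennreal (potential []) \<le> 2"
    by (metis ennreal_leI ennreal_numeral)
  then show ?case
    by (simp add: nn_integral_count_space_finite)
next
  case (Suc n)
  have "(\<integral>\<^sup>+x. potential x \<partial>count_space {x. length x = Suc n})
      \<le> (\<integral>\<^sup>+x. potential x \<partial>count_space {x. length x = n})"
    unfolding nn_integral_count_space_length_Suc by (intro nn_integral_mono potential_snoc_le)
  with Suc show ?case by simp
qed

section \<open>From the mixture to a single measure, and from exponential moments to
  expectations\<close>

text \<open>Dominance \<open>w \<mu> * cprob \<mu> x <= mix w M x\<close> makes the change of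
  measure cost a factor \<open>1 / w \<mu>\<close>; the nonnegative entropy part is
  discarded.\<close>

lemma nn_integral_exp_cum_gain_le:
  assumes \<mu>: "\<mu> \<in> M"
  shows "(\<integral>\<^sup>+\<omega>. exp (cum_gain (stake n \<omega>) / (2 * ent_bound)) \<partial>\<mu>) \<le> ennreal (2 / w \<mu>)"
proof -
  interpret prob_space \<mu> by (rule prob_M[OF \<mu>])
  have w: "0 < w \<mu>" by (rule w_pos[OF \<mu>])
  have le: "exp (cum_gain x / (2 * ent_bound)) * cprob \<mu> x \<le> 1 / w \<mu> * potential x" for x
  proof -
    have "w \<mu> * cprob \<mu> x \<le> mix w M x + ent x / ent_bound"
      using joint_le_mix[OF \<mu>, of x] ent_nonneg[of x] ent_bound_pos by (simp add: joint_def add_increasing2)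
    then have "exp (cum_gain x / (2 * ent_bound)) * (w \<mu> * cprob \<mu> x) \<le> potential x"
      unfolding potential_def by (intro mult_left_mono) auto
    then show ?thesis
      using w by (simp add: field_simps)
  qed
  have "(\<integral>\<^sup>+\<omega>. exp (cum_gain (stake n \<omega>) / (2 * ent_bound)) \<partial>\<mu>)
      = (\<integral>\<^sup>+x. ennreal (exp (cum_gain x / (2 * ent_bound))) * emeasure \<mu> (cyl x) \<partial>count_space {x. length x = n})"
    by (rule nn_integral_stake[OF sets_M[OF \<mu>]])
  also have "\<dots> \<le> (\<integral>\<^sup>+x. ennreal (1 / w \<mu>) * ennreal (potential x) \<partial>count_space {x. length x = n})"
  proof (rule nn_integral_mono)
    show "ennreal (exp (cum_gain x / (2 * ent_bound))) * emeasure \<mu> (cyl x) \<le> ennreal (1 / w \<mu>) * ennreal (potential x)" for x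
      using ennreal_leI[OF le[of x]] w potential_nonneg[of x]
      by (simp add: emeasure_eq_measure cprob_def ennreal_mult del: times_divide_eq_left)
  qed
  also have "\<dots> = ennreal (1 / w \<mu>) * (\<integral>\<^sup>+x. potential x \<partial>count_space {x. length x = n})"
    by (simp add: nn_integral_cmult)
  also have "\<dots> \<le> ennreal (1 / w \<mu>) * 2"
    by (intro mult_left_mono nn_integral_potential_le) auto
  also have "\<dots> = ennreal (2 / w \<mu>)"
    using w by (simp add: ennreal_mult[symmetric] flip: ennreal_numeral)
  finally show ?thesis .
qed

lemma w_le_1: "\<nu> \<in> M \<Longrightarrow> w \<nu> \<le> 1"
  using member_le_sum[of \<nu> M w] finite_M w_pos sum_w by (simp add: less_imp_le)

lemma nn_integral_cum_gain_le:
  assumes \<mu>: "\<mu> \<in> M"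
  shows "(\<integral>\<^sup>+\<omega>. cum_gain (stake n \<omega>) \<partial>\<mu>) \<le> ennreal (2 * ent_bound * (ln (2 / w \<mu>) + 1))"
proof -
  interpret prob_space \<mu> by (rule prob_M[OF \<mu>])
  have [measurable]: "stake n \<in> measurable \<mu> (count_space UNIV)"
    using measurable_stake by (subst measurable_cong_sets[OF sets_M[OF \<mu>] refl])
  have w: "0 < w \<mu>" by (rule w_pos[OF \<mu>])
  let ?l = "ln (2 / w \<mu>)" and ?e = "\<lambda>x. exp (cum_gain x / (2 * ent_bound))"
  have l: "0 \<le> ?l" using w w_le_1[OF \<mu>] by simp
  have "cum_gain x \<le> 2 * ent_bound * ?l + ent_bound * w \<mu> * ?e x" for x
  proof -
    \<comment> \<open>The shift \<open>?l\<close> is the logarithm of the exponential moment bound,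
      so the right-hand side has expectation at most 1.\<close>
    have "cum_gain x / (2 * ent_bound) - ?l \<le> exp (cum_gain x / (2 * ent_bound) - ?l)"
      using exp_ge_add_one_self[of "cum_gain x / (2 * ent_bound) - ?l"] by linarith
    also have "\<dots> = ?e x * (w \<mu> / 2)"
      using w by (simp add: exp_diff)
    finally show ?thesis
      using ent_bound_pos by (simp add: field_simps)
  qed
  then have "(\<integral>\<^sup>+\<omega>. cum_gain (stake n \<omega>) \<partial>\<mu>)
      \<le> (\<integral>\<^sup>+\<omega>. ennreal (2 * ent_bound * ?l) + ennreal (ent_bound * w \<mu>) * ennreal (?e (stake n \<omega>)) \<partial>\<mu>)"
    using ent_bound_pos w l
    by (intro nn_integral_mono) (simp add: ennreal_leI flip: ennreal_mult ennreal_plus)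
  also have "\<dots> = ennreal (2 * ent_bound * ?l) + ennreal (ent_bound * w \<mu>) * (\<integral>\<^sup>+\<omega>. ?e (stake n \<omega>) \<partial>\<mu>)"
    by (simp add: nn_integral_add nn_integral_cmult emeasure_space_1)
  also have "\<dots> \<le> ennreal (2 * ent_bound * ?l) + ennreal (ent_bound * w \<mu>) * ennreal (2 / w \<mu>)"
    by (intro add_left_mono mult_left_mono nn_integral_exp_cum_gain_le \<mu>) auto
  also have "\<dots> = ennreal (2 * ent_bound * (?l + 1))"
    using ent_bound_pos w l
    by (simp add: algebra_simps flip: ennreal_mult ennreal_plus)
  finally show ?thesis .
qed

theorem nn_integral_Cinf_le:
  assumes \<mu>: "\<mu> \<in> M"
  shows "(\<integral>\<^sup>+\<omega>. Cinf w M \<omega> \<partial>\<mu>) \<le> ennreal (2 * (ln (real (card M)) + 1) * (ln (2 / w \<mu>) + 1))"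
proof -
  have [measurable]: "stake n \<in> measurable \<mu> (count_space UNIV)" for n
    using measurable_stake by (subst measurable_cong_sets[OF sets_M[OF \<mu>] refl])
  have "(\<integral>\<^sup>+\<omega>. Cinf w M \<omega> \<partial>\<mu>) = (\<integral>\<^sup>+\<omega>. (\<Sum>t. ennreal (gain (stake t \<omega>))) \<partial>\<mu>)"
    by (simp add: Cinf_def ct_def gain_def)
  also have "\<dots> = (\<Sum>t. \<integral>\<^sup>+\<omega>. gain (stake t \<omega>) \<partial>\<mu>)"
    by (rule nn_integral_suminf) measurable
  also have "\<dots> \<le> ennreal (2 * ent_bound * (ln (2 / w \<mu>) + 1))"
  \<comment> \<open>The bound is uniform in \<open>n\<close>, so it suffices to treat partial sums,
    which are expectations of \<open>cum_gain\<close>.\<close>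
  proof (rule suminf_le_const)
    fix n
    have "(\<Sum>t<n. \<integral>\<^sup>+\<omega>. gain (stake t \<omega>) \<partial>\<mu>) = (\<integral>\<^sup>+\<omega>. (\<Sum>t<n. ennreal (gain (stake t \<omega>))) \<partial>\<mu>)"
      by (rule nn_integral_sum[symmetric]) measurable
    also have "\<dots> = (\<integral>\<^sup>+\<omega>. cum_gain (stake n \<omega>) \<partial>\<mu>)"
      by (simp add: cum_gain_stake sum_ennreal gain_nonneg)
    also have "\<dots> \<le> ennreal (2 * ent_bound * (ln (2 / w \<mu>) + 1))"
      by (rule nn_integral_cum_gain_le[OF \<mu>])
    finally show "(\<Sum>t<n. \<integral>\<^sup>+\<omega>. gain (stake t \<omega>) \<partial>\<mu>) \<le> ennreal (2 * ent_bound * (ln (2 / w \<mu>) + 1))" .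
  qed simp
  finally show ?thesis
    by (simp add: ent_bound_def)
qed

end

text \<open>The uniform prior turns \<open>2 / w \<mu>\<close> into twice the number of measures;
  the rest is a numerical comparison.\<close>

theorem theorem5:
  fixes \<M> :: "('a::countable) stream measure set" and \<mu> :: "'a stream measure"
  assumes "finite \<M>"
    and "\<And>\<nu>. \<nu> \<in> \<M> \<Longrightarrow> prob_space \<nu>"
    and "\<And>\<nu>. \<nu> \<in> \<M> \<Longrightarrow> sets \<nu> = sets (stream_space (count_space UNIV))"
    and "\<mu> \<in> \<M>"
  shows "(\<integral>\<^sup>+ \<omega>. Cinf (\<lambda>_. 1 / real (card \<M>)) \<M> \<omega> \<partial>\<mu>)
           \<le> ennreal (6 * (ln (real (card \<M>)))\<^sup>2 + 14 * ln (real (card \<M>)) + 8)"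
proof -
  let ?K = "real (card \<M>)"
  have K: "1 \<le> ?K"
    using assms(1,4) by (auto simp: Suc_le_eq card_gt_0_iff)
  interpret bayes_mixture \<M> "\<lambda>_. 1 / ?K"
    by (intro bayes_mixture.intro assms) (use K in auto)
  have L: "0 \<le> ln ?K" using K by simp
  have "ln (2 / (1 / ?K)) = ln 2 + ln ?K"
    using K by (simp add: ln_mult)
  also have "\<dots> \<le> 1 + ln ?K"
    using ln_le_minus_one[of 2] by simp
  finally have "2 * (ln ?K + 1) * (ln (2 / (1 / ?K)) + 1) \<le> 2 * (ln ?K + 1) * (1 + ln ?K + 1)"
    using L by (intro mult_left_mono) auto
  \<comment> \<open>With \<open>L = ln ?K\<close>, the left side is
    \<open>2 * L^2 + 6 * L + 4\<close>; the slack is \<open>4 * (L + 1)^2\<close>.\<close>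
  also have "\<dots> \<le> 6 * (ln ?K)\<^sup>2 + 14 * ln ?K + 8"
    using L zero_le_power2[of "ln ?K"] by (simp add: algebra_simps power2_eq_square)
  finally show ?thesis
    using nn_integral_Cinf_le[OF assms(4)] by (meson ennreal_leI order_trans)
qed

end
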